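(* Let $F$ be a field of characteristic not $2$, let $L/F$ be a quartic field extension, and let $x\in L$ be a primitive element with minimal polynomial $P(X)=X^4+uX^3+vX^2+wX+z$ over $F$. Put $P_0=P(-\tfrac{u}{4})$, $P_1=P'(-\tfrac{u}{4})$, $P_2=P''(-\tfrac{u}{4})$. \begin{enumerate} \item If $P_1=0$, then $y=x+\tfrac{u}{4}$ is a primitive element of $L/F$ with minimal polynomial $X^4+\tfrac12P_2X^2+P_0$. \item If $P_1\neq 0$, then (a) $y=\frac{P_0}{P_1}\left(x+\tfrac{u}{4}\right)$ is a primitive element of $L/F$ with minimal polynomial $X^4+aX^2+bX+b$, where $a=\frac{P_1^2P_2}{2P_0^2}$ and $b=\frac{P_1^4}{P_0^3}$; (b) $\zeta=\frac{4P_0}{P_1(4x+u)}$ is a primitive element of $L/F$ with minimal polynomial $X^4+X^3+cX^2+d$, where $c=\frac{P_2P_0}{2P_1^2}$ and $d=\frac{P_0^3}{P_1^4}$. \end{enumerate}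
   Context: $F$ is a field of characteristic different from $2$. A quartic extension $L/F$ is one having a primitive element whose minimal polynomial over $F$ has degree $4$. $P',P''$ denote the first and second derivatives of $P$.
   Formalization: In part 2(a) the element is taken to be y = (P_1/P_0)(x+u/4) instead of the printed (P_0/P_1)(x+u/4), which is false with the stated a, b (e.g. P = X^4+4X+2 over Q gives X^4+X/2+1/8, not X^4+32X+32). *)

theory Defs
  imports
    "HOL-Algebra.Finite_Extensions"
    "HOL-Algebra.Generated_Fields"
    "HOL-Algebra.Multiplicative_Group"
begin

definition ring_div :: "('a, 'b) ring_scheme \<Rightarrow> 'a \<Rightarrow> 'a \<Rightarrow> 'a" (infixl \<open>\<oslash>\<index>\<close> 70)
  where "a \<oslash>\<^bsub>R\<^esub> b = a \<otimes>\<^bsub>R\<^esub> inv\<^bsub>R\<^esub> b"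

(* group.ord is 0 for elements of infinite order, so this is the usual characteristic. *)
definition ring_char :: "('a, 'b) ring_scheme \<Rightarrow> nat"
  where "ring_char R = group.ord (add_monoid R) \<one>\<^bsub>R\<^esub>"

(* Polynomials are coefficient lists, leading coefficient first; normalize drops the leading
   zeros that differentiation can produce in positive characteristic. *)
definition (in ring) formal_deriv :: "'a list \<Rightarrow> 'a list"
  where "formal_deriv p = normalize (map (\<lambda>i. [i] \<cdot> coeff p i) (rev [1..<length p]))"

definition primitive_element :: "('a, 'b) ring_scheme \<Rightarrow> 'a set \<Rightarrow> 'a \<Rightarrow> bool"
  where "primitive_element L F x \<longleftrightarrow>
    x \<in> carrier L \<and> generate_field L (insert x F) = carrier L"

(* Irr is a definite description that is only meaningful for algebraic elements. *)
definition has_min_poly :: "('a, 'b) ring_scheme \<Rightarrow> 'a set \<Rightarrow> 'a \<Rightarrow> 'a list \<Rightarrow> bool"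
  where "has_min_poly L F x P \<longleftrightarrow>
    x \<in> carrier L \<and> (ring.algebraic L over F) x \<and> ring.Irr L F x = P"

definition quartic_extension :: "('a, 'b) ring_scheme \<Rightarrow> 'a set \<Rightarrow> bool"
  where "quartic_extension L F \<longleftrightarrow>
    field L \<and> subfield F L \<and>
    (\<exists>x P. primitive_element L F x \<and> has_min_poly L F x P \<and> degree P = 4)"

end

theory Submission
  imports Defs
begin

text \<open>
  Taylor expansion of \<open>P\<close> at \<open>- u/4\<close> kills the cubic term, so \<open>t = x + u/4\<close> is a root of
  \<open>X\<^sup>4 + (P2/2) X\<^sup>2 + P1 X + P0\<close>. For \<open>P1 \<noteq> 0\<close> the scaling factor \<open>k = P1/P0\<close> is the one for which
  \<open>k\<^sup>3 P1 = k\<^sup>4 P0\<close>, i.e. the last two coefficients for \<open>k t\<close> coincide; the reciprocal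
  polynomial then serves \<open>1/(k t)\<close>. Here \<open>P0 \<noteq> 0\<close>, as otherwise the minimal polynomial of \<open>t\<close>
  would have the root 0. All these elements generate \<open>L\<close>, and a monic polynomial of degree
  \<open>[L : F]\<close> annihilating a generator is its minimal polynomial.
\<close>

section \<open>Quotients and characteristic not 2\<close>

lemma (in field) div_eq_iff:
  assumes "a \<in> carrier R" "b \<in> carrier R" "c \<in> carrier R" "b \<noteq> \<zero>"
  shows "a \<oslash> b = c \<longleftrightarrow> a = c \<otimes> b"
proof -
  have "b \<in> Units R" using assms field_Units by auto
  then show ?thesis
    using assms m_assoc[of a "inv b" b] m_assoc[of c b "inv b"] unfolding ring_div_def by auto
qed

text \<open>If twice the unit vanished, the additive order of the unit would divide 2. It is not 1
  because the unit is nonzero, so it would be 2. Restricting the carrier to \<open>F\<close> keeps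
  the operations, so the order taken in \<open>F\<close> says something about
  \<open>R\<close>.\<close>

lemma (in field) two_nonzero_if_ring_char:
  assumes "subfield F R" and "ring_char (R\<lparr>carrier := F\<rparr>) \<noteq> 2"
  shows "[(2::nat)] \<cdot> \<one> \<noteq> \<zero>"
proof
  assume two: "[(2::nat)] \<cdot> \<one> = \<zero>"
  interpret K: field "R\<lparr>carrier := F\<rparr>"
    using subfield_iff(2)[OF assms(1)] .
  let ?G = "add_monoid (R\<lparr>carrier := F\<rparr>)"
  have G: "group ?G" by (rule K.add.is_group)
  have one: "\<one> \<in> carrier ?G" using K.one_closed by simp
  have "\<one> [^]\<^bsub>?G\<^esub> (2::nat) = \<one>\<^bsub>?G\<^esub>"
    using two by (simp add: add_pow_def nat_pow_def)
  then have dvd: "group.ord ?G \<one> dvd 2"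
    using group.pow_eq_id[OF G one] by simp
  then have "group.ord ?G \<one> \<le> 2"
    by (rule dvd_imp_le) simp
  moreover have "group.ord ?G \<one> \<noteq> 0"
    using dvd by (metis dvd_0_left_iff zero_neq_numeral)
  moreover have "group.ord ?G \<one> \<noteq> 1"
    using group.ord_eq_1[OF G one] by simp
  moreover have "group.ord ?G \<one> \<noteq> 2"
    using assms(2) by (simp add: ring_char_def)
  ultimately show False by linarith
qed

section \<open>Primitive elements and recognition of minimal polynomials\<close>

lemma (in domain) eval_min_poly:
  assumes "subfield F R" and "has_min_poly R F x p"
  shows "eval p x = \<zero>"
  using assms IrrE(4)[OF assms(1)] unfolding has_min_poly_def by blast

lemma (in field) primitive_element_transfer:
  assumes "subfield F R" and "primitive_element R F x" and "y \<in> carrier R"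
    and "x \<in> generate_field R (insert y F)"
  shows "primitive_element R F y"
proof -
  have sub: "insert y F \<subseteq> carrier R"
    using assms(1,3) subfieldE(3) by auto
  have "insert x F \<subseteq> generate_field R (insert y F)"
    using assms(4) by (auto intro: generate_field.incl)
  then have "generate_field R (insert x F) \<subseteq> generate_field R (insert y F)"
    using generate_field_min_subfield1 generate_field_is_subfield[OF sub]
      generate_field_incl[OF sub] by (meson order_trans)
  then show ?thesis
    using assms generate_field_incl[OF sub] unfolding primitive_element_def by auto
qed

text \<open>For algebraic \<open>x\<close> the ring generated over \<open>F\<close> is already a
  field, so it contains the generated field. This links \<open>primitive_element\<close> to the
  dimension formula for simple extensions.\<close>

lemma (in field) simple_extension_primitive_element:
  assumes "subfield F R" and "primitive_element R F x" and "(algebraic over F) x"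
  shows "simple_extension F x = carrier R"
proof
  have x: "x \<in> carrier R" using assms(2) by (simp add: primitive_element_def)
  have F: "F \<subseteq> carrier R" using assms(1) subfieldE(3) by auto
  show "simple_extension F x \<subseteq> carrier R"
    by (rule simple_extension_in_carrier[OF F x])
  have "insert x F \<subseteq> simple_extension F x"
    using simple_extension_mem[OF subfieldE(1)[OF assms(1)] x] simple_extension_incl[OF F x] by auto
  then have "generate_field R (insert x F) \<subseteq> simple_extension F x"
    using generate_field_min_subfield1 simple_extension_is_subfield[OF assms(1) x] assms(3) x F
    by simp
  then show "carrier R \<subseteq> simple_extension F x"
    using assms(2) by (simp add: primitive_element_def)
qed

text \<open>The minimal polynomial divides \<open>q\<close>. The degree bound makes the cofactor
  constant, and comparing leading coefficients makes it one.\<close>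

lemma (in domain) Irr_eqI:
  assumes "subfield F R" and "y \<in> carrier R" and "q \<in> carrier (F[X])" "q \<noteq> []"
    and "lead_coeff q = \<one>" "eval q y = \<zero>" "degree q \<le> degree (Irr F y)"
  shows "Irr F y = q"
proof -
  have alg: "(algebraic over F) y"
    using algebraicI assms(3,4,6) by blast
  note Irr = IrrE[OF assms(1,2) alg]
  have "Irr F y pdivides q"
    by (rule Irr_minimal[OF assms(1,2) alg assms(3,6)])
  then obtain s where s: "s \<in> carrier (F[X])" "q = Irr F y \<otimes>\<^bsub>F[X]\<^esub> s"
    using pdivides_iff_shell[OF assms(1) Irr(1) assms(3)] unfolding factor_def by auto
  have poly: "polynomial F (Irr F y)" "polynomial F s"
    using Irr(1) s(1) by (simp_all add: univ_poly_carrier)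
  \<comment> \<open>The zero polynomial \<open>[]\<close> also has degree 0, so it has to be
    excluded before degrees add up and before degree 0 yields a one-element list.\<close>
  have ne: "Irr F y \<noteq> []" "s \<noteq> []"
    using assms(4) s(2) poly_mult_zero[OF polynomial_in_carrier[OF subfieldE(1)[OF assms(1)] poly(1)]]
    by (auto simp: univ_poly_mult)
  have "degree q = degree (Irr F y) + degree s"
    using poly_mult_degree_eq[OF subfieldE(1)[OF assms(1)] poly] ne
    by (simp add: s(2) univ_poly_mult)
  then have "degree s = 0" using assms(7) by simp
  then obtain c where c: "s = [c]" using ne(2) by (cases s) auto
  have "lead_coeff q = lead_coeff (Irr F y) \<otimes> lead_coeff s"
    using poly_mult_lead_coeff[OF subfieldE(1)[OF assms(1)] poly ne] by (simp add: s(2) univ_poly_mult)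
  moreover have "c \<in> carrier R"
    using poly(2) assms(1) subfieldE(3) by (auto simp: c polynomial_def)
  ultimately have "s = \<one>\<^bsub>F[X]\<^esub>"
    using assms(5) Irr(3) by (simp add: c univ_poly_one)
  then show ?thesis
    using s(2) Irr(1) monoid.r_one[OF ring.is_monoid[OF univ_poly_is_ring[OF subfieldE(1)[OF assms(1)]]]]
    by simp
qed

text \<open>The minimal polynomials of \<open>x\<close> and \<open>y\<close> have the same degree,
  since each degree is the dimension of the whole field over \<open>F\<close>. A monic annihilating
  polynomial of that degree can only be the minimal one.\<close>

lemma (in field) has_min_poly_primitive_elementI:
  assumes F: "subfield F R" and x: "primitive_element R F x" "has_min_poly R F x p"
    and y: "primitive_element R F y"
    and q: "set q \<subseteq> F" "q \<noteq> []" "lead_coeff q = \<one>" "degree q = degree p" "eval q y = \<zero>"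
  shows "has_min_poly R F y q"
proof -
  have carr: "x \<in> carrier R" "y \<in> carrier R"
    using x(1) y by (simp_all add: primitive_element_def)
  have q_poly: "q \<in> carrier (F[X])"
    using q(1-3) by (simp add: univ_poly_def polynomial_def)
  have alg: "(algebraic over F) x" "(algebraic over F) y"
    using x(2) algebraicI[OF q_poly q(2,5)] by (simp_all add: has_min_poly_def)
  have "degree (Irr F y) = degree (Irr F x)"
    using simple_extension_dim[OF F carr(1) alg(1)] simple_extension_dim[OF F carr(2) alg(2)]
      simple_extension_primitive_element[OF F x(1) alg(1)]
      simple_extension_primitive_element[OF F y alg(2)] by simp
  then have "Irr F y = q"
    using Irr_eqI[OF F carr(2) q_poly] q x(2) by (simp add: has_min_poly_def)
  then show ?thesis
    using carr alg by (simp add: has_min_poly_def)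
qed

text \<open>By uniqueness, an irreducible monic \<open>p\<close> with a root \<open>a\<close> in
  \<open>F\<close> is also the minimal polynomial of \<open>a\<close>, which divides
  \<open>X - a\<close>. With \<open>a = 0\<close> this shows that constant terms are nonzero in
  higher degree.\<close>

lemma (in domain) min_poly_root_imp_degree_1:
  assumes "subfield F R" and "has_min_poly R F x p" and "a \<in> F" "eval p a = \<zero>"
  shows "degree p = 1"
proof -
  have x: "x \<in> carrier R" "(algebraic over F) x" "Irr F x = p"
    using assms(2) by (simp_all add: has_min_poly_def)
  note Irr = IrrE[OF assms(1) x(1,2), unfolded x(3)]
  have a: "a \<in> carrier R" using assms(1,3) subfieldE(3) by auto
  have alg: "(algebraic over F) a" 
    by (rule algebraic_self[OF subfieldE(1)[OF assms(1)] assms(3)])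
  have "Irr F a = p"
    using minimal_polynomial_is_unique[OF assms(1) a alg] IrrE[OF assms(1) a alg] Irr assms(4)
    by blast
  have m: "\<ominus> a \<in> F" "\<one> \<in> F"
    using subringE(3,5)[OF subfieldE(1)[OF assms(1)]] assms(3) by auto
  have "p pdivides [\<one>, \<ominus> a]"
    unfolding \<open>Irr F a = p\<close>[symmetric]
    using m a by (intro Irr_minimal[OF assms(1) a alg]) (auto simp: univ_poly_def polynomial_def r_neg)
  then have "degree p \<le> 1"
    using pdivides_imp_degree_le[OF subfieldE(1)[OF assms(1)] Irr(1), of "[\<one>, \<ominus> a]"] m
    by (auto simp: univ_poly_def polynomial_def)
  moreover have "degree p \<ge> 1"
    using pirreducible_degree[OF assms(1) Irr(1,2)] .
  ultimately show ?thesis by simp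
qed

section \<open>Identities for quartic polynomials\<close>

text \<open>Taylor expansion at \<open>a\<close>. The quadratic coefficient is half the second
  derivative, written without division so that the identity holds in every commutative ring.\<close>

lemma (in cring) eval_monic_quartic_add:
  assumes "u \<in> carrier R" "v \<in> carrier R" "w \<in> carrier R" "z \<in> carrier R"
    and "a \<in> carrier R" "t \<in> carrier R"
  shows "eval [\<one>, u, v, w, z] (t \<oplus> a) =
    eval [\<one>, [(4::nat)] \<cdot> a \<oplus> u, [(6::nat)] \<cdot> (a \<otimes> a) \<oplus> [(3::nat)] \<cdot> (u \<otimes> a) \<oplus> v,
          eval [[(4::nat)] \<cdot> \<one>, [(3::nat)] \<cdot> u, [(2::nat)] \<cdot> v, w] a, eval [\<one>, u, v, w, z] a] t"
proof -
  \<comment> \<open>These are coefficients in \<open>t\<close> of the successive Horner stages: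
    \<open>p = 2a + u\<close>, \<open>q = a^2 + ua + v\<close>, then \<open>p' = 3a + u\<close>,
    \<open>q' = 3a^2 + 2ua + v\<close> and \<open>r = a^3 + ua^2 + va + w\<close>. Expanding stage
    by stage keeps each algebraic goal small.\<close>
  define p where "p = a \<oplus> a \<oplus> u"
  define q where "q = (a \<oplus> u) \<otimes> a \<oplus> v"
  define p' where "p' = p \<oplus> a"
  define q' where "q' = q \<oplus> a \<otimes> p"
  define r where "r = a \<otimes> q \<oplus> w"
  have carr: "p \<in> carrier R" "p' \<in> carrier R" "q \<in> carrier R" "q' \<in> carrier R" "r \<in> carrier R"
    using assms by (simp_all add: p_def p'_def q_def q'_def r_def)
  let ?s = "t \<oplus> a"
  have "eval [\<one>, u, v, w, z] ?s = (((?s \<oplus> u) \<otimes> ?s \<oplus> v) \<otimes> ?s \<oplus> w) \<otimes> ?s \<oplus> z"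
    using assms(1-4) a_closed[OF assms(6,5)] by (simp add: numeral_eq_Suc) algebra
  also have "(?s \<oplus> u) \<otimes> ?s \<oplus> v = t \<otimes> t \<oplus> p \<otimes> t \<oplus> q"
    using assms unfolding p_def q_def by algebra
  also have "(t \<otimes> t \<oplus> p \<otimes> t \<oplus> q) \<otimes> ?s \<oplus> w
      = t \<otimes> t \<otimes> t \<oplus> p' \<otimes> (t \<otimes> t) \<oplus> q' \<otimes> t \<oplus> r"
    using assms carr(1,3) unfolding p'_def q'_def r_def by algebra
  also have "(t \<otimes> t \<otimes> t \<oplus> p' \<otimes> (t \<otimes> t) \<oplus> q' \<otimes> t \<oplus> r) \<otimes> ?s \<oplus> z
      = eval [\<one>, p' \<oplus> a, q' \<oplus> a \<otimes> p', r \<oplus> a \<otimes> q', a \<otimes> r \<oplus> z] t"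
    using assms carr by (simp add: numeral_eq_Suc) algebra
  also have "p' \<oplus> a = [(4::nat)] \<cdot> a \<oplus> u"
    using assms by (simp add: p'_def p_def numeral_eq_Suc) algebra
  also have "q' \<oplus> a \<otimes> p' = [(6::nat)] \<cdot> (a \<otimes> a) \<oplus> [(3::nat)] \<cdot> (u \<otimes> a) \<oplus> v"
    using assms by (simp add: p'_def q'_def p_def q_def numeral_eq_Suc) algebra
  also have "r \<oplus> a \<otimes> q' = eval [[(4::nat)] \<cdot> \<one>, [(3::nat)] \<cdot> u, [(2::nat)] \<cdot> v, w] a"
    using assms by (simp add: r_def p'_def q'_def p_def q_def numeral_eq_Suc) algebra
  also have "a \<otimes> r \<oplus> z = eval [\<one>, u, v, w, z] a"
    using assms by (simp add: r_def q_def numeral_eq_Suc) algebra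
  finally show ?thesis .
qed

lemma (in cring) eval_second_deriv_quartic:
  assumes "u \<in> carrier R" "v \<in> carrier R" "a \<in> carrier R"
  shows "eval [[(3::nat)] \<cdot> ([(4::nat)] \<cdot> \<one>), [(2::nat)] \<cdot> ([(3::nat)] \<cdot> u), [(2::nat)] \<cdot> v] a =
    [(2::nat)] \<cdot> ([(6::nat)] \<cdot> (a \<otimes> a) \<oplus> [(3::nat)] \<cdot> (u \<otimes> a) \<oplus> v)"
  using assms by (simp add: add_pow_ldistr add.nat_pow_pow add.nat_pow_distrib numeral_2_eq_2 a_assoc
      del: add.nat_pow_Suc)

text \<open>Since 4 is nonzero, \<open>normalize\<close> leaves the list of derivative coefficients
  intact.\<close>

lemma (in ring) formal_deriv_monic_quartic:
  assumes "u \<in> carrier R" "v \<in> carrier R" "w \<in> carrier R" "[(4::nat)] \<cdot> \<one> \<noteq> \<zero>"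
  shows "formal_deriv [\<one>, u, v, w, z] = [[(4::nat)] \<cdot> \<one>, [(3::nat)] \<cdot> u, [(2::nat)] \<cdot> v, w]"
  using assms unfolding formal_deriv_def by (simp add: upt_rec numeral_eq_Suc)

text \<open>In characteristic 3 the leading coefficient vanishes and \<open>normalize\<close>
  shortens the list, so only values are compared; these do not change under
  \<open>normalize\<close>.\<close>

lemma (in ring) eval_formal_deriv_cubic:
  assumes "p \<in> carrier R" "u \<in> carrier R" "v \<in> carrier R" "w \<in> carrier R" "a \<in> carrier R"
  shows "eval (formal_deriv [p, u, v, w]) a = eval [[(3::nat)] \<cdot> p, [(2::nat)] \<cdot> u, v] a"
  using assms unfolding formal_deriv_def by (subst eval_normalize) (auto simp: upt_rec numeral_eq_Suc)

text \<open>Weighted homogeneity: the coefficient of \<open>X^(4-i)\<close> is multiplied by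
  \<open>k^i\<close>.\<close>

lemma (in cring) eval_quartic_scale:
  assumes "k \<in> carrier R" "t \<in> carrier R" "a \<in> carrier R" "b \<in> carrier R" "c \<in> carrier R"
  shows "eval [\<one>, \<zero>, k [^] (2::nat) \<otimes> a, k [^] (3::nat) \<otimes> b, k [^] (4::nat) \<otimes> c] (k \<otimes> t) =
    k [^] (4::nat) \<otimes> eval [\<one>, \<zero>, a, b, c] t"
  using assms by (simp add: numeral_eq_Suc) algebra

lemma (in field) eval_quartic_inverse:
  assumes "y \<in> carrier R" "a \<in> carrier R" "b \<in> carrier R" "y \<noteq> \<zero>" "b \<noteq> \<zero>"
    and "eval [\<one>, \<zero>, a, b, b] y = \<zero>"
  shows "eval [\<one>, \<one>, a \<otimes> inv b, \<zero>, inv b] (inv y) = \<zero>"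
proof -
  have "y \<in> Units R" "b \<in> Units R" using assms field_Units by auto
  then obtain s i where s: "s = inv y" "s \<in> carrier R" "s \<otimes> y = \<one>"
    and i: "i = inv b" "i \<in> carrier R" "i \<otimes> b = \<one>"
    by auto
  \<comment> \<open>Dividing the equation by \<open>b y^4\<close> reverses the coefficients. The
    equal last two become the two leading ones of the reciprocal polynomial.\<close>
  have "\<zero> = i \<otimes> (s [^] (4::nat)) \<otimes> eval [\<one>, \<zero>, a, b, b] y"
    using assms s i by simp
  also have "\<dots> = i \<otimes> (s \<otimes> y) [^] (4::nat) \<oplus> i \<otimes> a \<otimes> (s \<otimes> y) [^] (2::nat) \<otimes> s [^] (2::nat)
      \<oplus> (i \<otimes> b) \<otimes> (s \<otimes> y) \<otimes> s [^] (3::nat) \<oplus> (i \<otimes> b) \<otimes> s [^] (4::nat)"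
    using assms(1-3) s(2) i(2) by (simp add: numeral_eq_Suc) algebra
  also have "\<dots> = eval [\<one>, \<one>, a \<otimes> i, \<zero>, i] s"
    using assms(1-3) s(2) i(2) unfolding s(3) i(3) by (simp add: numeral_eq_Suc) algebra
  finally show ?thesis using s(1) i(1) by simp
qed

section \<open>Coefficients stay in the base field\<close>

lemma (in ring) add_pow_in_subring:
  assumes "subring K R" "a \<in> K"
  shows "[(n::nat)] \<cdot> a \<in> K"
  using subringE(2,7)[OF assms(1)] assms(2) by (induct n) auto

lemma (in ring) eval_in_subring:
  assumes "subring K R" "set p \<subseteq> K" "a \<in> K"
  shows "eval p a \<in> K"
  using ring.eval_in_carrier[OF subring_is_ring[OF assms(1)], of p a] assms(2,3)
  unfolding eval_consistent[OF assms(1)] by simp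

section \<open>Normal forms of a depressed quartic with nonzero linear term\<close>

text \<open>Here \<open>h\<close>, \<open>p\<close>, \<open>r\<close> stand for half of
  \<open>P2\<close>, \<open>P1\<close> and \<open>P0\<close>, and \<open>t\<close> for
  \<open>x + u/4\<close>. Scaling \<open>t\<close> by \<open>p/r\<close> gives the first form, and
  inverting the result gives the second.\<close>

lemma (in field) quartic_normal_forms:
  assumes F: "subfield F R" and two: "[(2::nat)] \<cdot> \<one> \<noteq> \<zero>"
    and t: "primitive_element R F t" "has_min_poly R F t [\<one>, \<zero>, h, p, r]"
    and hpr: "h \<in> F" "p \<in> F" "r \<in> F" and p: "p \<noteq> \<zero>"
    and c2: "c2 = [(2::nat)] \<cdot> h"
    and y_def: "y = (p \<oslash> r) \<otimes> t"
    and a_def: "a = (p [^] (2::nat) \<otimes> c2) \<oslash> ([(2::nat)] \<cdot> (r [^] (2::nat)))"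
    and b_def: "b = p [^] (4::nat) \<oslash> r [^] (3::nat)"
    and \<zeta>_def: "\<zeta> = ([(4::nat)] \<cdot> r) \<oslash> (p \<otimes> ([(4::nat)] \<cdot> t))"
    and c_def: "c = (c2 \<otimes> r) \<oslash> ([(2::nat)] \<cdot> (p [^] (2::nat)))"
    and d_def: "d = r [^] (3::nat) \<oslash> p [^] (4::nat)"
  shows "primitive_element R F y" "has_min_poly R F y [\<one>, \<zero>, a, b, b]"
    and "primitive_element R F \<zeta>" "has_min_poly R F \<zeta> [\<one>, \<one>, c, \<zero>, d]"
proof -
  note subr = subfieldE(1)[OF F]
  note cl = subringE(2,3,6,7)[OF subr]
  have FR: "F \<subseteq> carrier R" by (rule subfieldE(3)[OF F])
  have hprR: "h \<in> carrier R" "p \<in> carrier R" "r \<in> carrier R" using hpr FR by auto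
  have tR: "t \<in> carrier R" and evt: "eval [\<one>, \<zero>, h, p, r] t = \<zero>"
    using t eval_min_poly[OF F] by (simp_all add: primitive_element_def del: eval.simps)
  \<comment> \<open>The value at 0 is \<open>r\<close>, so \<open>r = 0\<close> would give a quartic
    minimal polynomial a root in \<open>F\<close>. If \<open>t\<close> were 0, then \<open>r\<close>
    would be 0.\<close>
  have r: "r \<noteq> \<zero>" and t0: "t \<noteq> \<zero>"
  proof -
    have "eval [\<one>, \<zero>, h, p, r] \<zero> = r"
      using hprR by (simp add: numeral_eq_Suc)
    then show "r \<noteq> \<zero>"
      using min_poly_root_imp_degree_1[OF F t(2) cl(1)] by auto
    then show "t \<noteq> \<zero>" using evt \<open>eval [\<one>, \<zero>, h, p, r] \<zero> = r\<close> by auto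
  qed
  have double: "[(2::nat)] \<cdot> s \<noteq> \<zero>" if "s \<in> carrier R" "s \<noteq> \<zero>" for s
    using that two add_pow_ldistr[of \<one> s 2] integral[of "[(2::nat)] \<cdot> \<one>" s] by auto
  define k where "k = p \<oslash> r"
  have inv_F: "inv s \<in> F" if "s \<in> F" "s \<noteq> \<zero>" for s
    using subfield_m_inv(1)[OF F] that by auto
  have kF: "k \<in> F" unfolding k_def ring_div_def using hpr r inv_F cl by auto
  have kR: "k \<in> carrier R" using kF FR by auto
  \<comment> \<open>Eliminating \<open>p\<close> in favour of \<open>k\<close> and \<open>r\<close>
    turns the formulas for \<open>a\<close> and \<open>b\<close> into polynomial identities once
    denominators are cleared.\<close>
  have pk: "p = k \<otimes> r" using div_eq_iff[of p r k] hprR kR r k_def by auto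
  have k0: "k \<noteq> \<zero>" using pk p hprR by auto
  have y: "y = k \<otimes> t" by (simp add: y_def k_def)
  have yR: "y \<in> carrier R" and y0: "y \<noteq> \<zero>"
    using y kR tR k0 t0 integral by auto
  have a: "a = k [^] (2::nat) \<otimes> h"
    unfolding a_def c2
    by (subst div_eq_iff) (use hprR kR r double in \<open>simp_all add: pk numeral_eq_Suc integral_iff, algebra?\<close>)
  have b: "b = k [^] (3::nat) \<otimes> p"
    unfolding b_def
    by (subst div_eq_iff) (use hprR kR r in \<open>simp_all add: pk numeral_eq_Suc integral_iff, algebra?\<close>)
  \<comment> \<open>Together with \<open>b\<close>, this says that the linear and the constant
    coefficient after scaling agree.\<close>
  have b': "b = k [^] (4::nat) \<otimes> r"
    using hprR(3) kR by (simp add: b pk numeral_eq_Suc) algebra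
  have b0: "b \<noteq> \<zero>"
    using hprR kR k0 r by (simp add: b' numeral_eq_Suc integral_iff)
  have abF: "a \<in> F" "b \<in> F"
    using kF hpr cl(3) kR by (auto simp: a b numeral_eq_Suc)
  have abR: "a \<in> carrier R" "b \<in> carrier R" using abF FR by auto
  have evy: "eval [\<one>, \<zero>, a, b, b] y = \<zero>"
    using eval_quartic_scale[OF kR tR hprR] evt kR unfolding a y by (simp add: b[symmetric] b'[symmetric])
  show primy: "primitive_element R F y"
  proof (rule primitive_element_transfer[OF F t(1) yR])
    have "t = inv k \<otimes> y"
      using kR tR k0 field_Units by (simp add: y m_assoc[symmetric])
    moreover have "inv k \<in> generate_field R (insert y F)" "y \<in> generate_field R (insert y F)"
      using inv_F[OF kF k0] by (auto intro: generate_field.incl)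
    ultimately show "t \<in> generate_field R (insert y F)"
      by (auto intro: generate_field.eng_mult)
  qed
  show miny: "has_min_poly R F y [\<one>, \<zero>, a, b, b]"
    by (rule has_min_poly_primitive_elementI[OF F t primy]) (use cl abF evy in auto)
  have units: "y \<in> Units R" "b \<in> Units R" "k \<in> Units R"
    using field_Units yR y0 abR b0 kR k0 by auto
  have four: "[(4::nat)] \<cdot> t \<noteq> \<zero>"
    using double[OF _ double[OF tR t0]] tR by (simp add: add.nat_pow_pow)
  \<comment> \<open>The factors 4 cancel, and \<open>y = k t\<close> with \<open>p = k r\<close>
    gives \<open>p t / y = r\<close>.\<close>
  have \<zeta>: "\<zeta> = inv y"
  proof -
    have "inv y \<otimes> (p \<otimes> ([(4::nat)] \<cdot> t)) = [(4::nat)] \<cdot> (inv y \<otimes> (p \<otimes> t))"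
      using hprR tR units by (simp add: add_pow_rdistr)
    also have "inv y \<otimes> (p \<otimes> t) = (inv y \<otimes> y) \<otimes> r"
      using hprR(3) tR kR Units_inv_closed[OF units(1)] unfolding pk y by algebra
    also have "\<dots> = r" using units hprR by simp
    finally show ?thesis
      unfolding \<zeta>_def
      by (subst div_eq_iff) (use hprR tR units p four in \<open>auto simp: integral_iff\<close>)
  qed
  have d: "d = inv b"
  proof -
    have "p [^] (4::nat) = b \<otimes> r [^] (3::nat)"
      unfolding b_def using div_eq_iff[of "p [^] (4::nat)" "r [^] (3::nat)" b] hprR r abR b_def
      by (simp add: numeral_eq_Suc integral_iff)
    then show ?thesis
      unfolding d_def
      by (subst div_eq_iff) (use hprR p abR units in \<open>auto simp: numeral_eq_Suc integral_iff m_assoc[symmetric]\<close>)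
  qed
  have c: "c = a \<otimes> inv b"
  proof -
    have i: "inv b \<in> carrier R" using units by simp
    \<comment> \<open>The powers of \<open>k\<close> from \<open>a\<close> and from
      \<open>p^2\<close> are collected into \<open>k^4 r\<close>, which is \<open>b\<close> and
      cancels against its inverse.\<close>
    have "a \<otimes> inv b \<otimes> ([(2::nat)] \<cdot> (p [^] (2::nat)))
        = ([(2::nat)] \<cdot> h) \<otimes> r \<otimes> (inv b \<otimes> (k [^] (4::nat) \<otimes> r))"
      using hprR(1,3) kR i unfolding a pk by (simp add: numeral_eq_Suc) algebra
    also have "\<dots> = c2 \<otimes> r"
      using units hprR by (simp add: b'[symmetric] c2)
    finally show ?thesis
      unfolding c_def
      by (subst div_eq_iff) (use hprR p abR units double in \<open>auto simp: c2 integral_iff numeral_eq_Suc\<close>)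
  qed
  have \<zeta>R: "\<zeta> \<in> carrier R" "\<zeta> \<noteq> \<zero>"
    using Units_inv_Units[OF units(1)] by (simp_all add: \<zeta> field_Units)
  show prim\<zeta>: "primitive_element R F \<zeta>"
  proof (rule primitive_element_transfer[OF F primy \<zeta>R(1)])
    have "y = inv \<zeta>" using units(1) by (simp add: \<zeta>)
    then show "y \<in> generate_field R (insert \<zeta> F)"
      using \<zeta>R(2) by (auto intro: generate_field.m_inv generate_field.incl)
  qed
  have "eval [\<one>, \<one>, c, \<zero>, d] \<zeta> = \<zero>"
    unfolding c d \<zeta> by (rule eval_quartic_inverse[OF yR abR y0 b0 evy])
  moreover have "c \<in> F" "d \<in> F"
    using inv_F[OF abF(2) b0] abF cl(3) by (auto simp: c d)
  ultimately show "has_min_poly R F \<zeta> [\<one>, \<one>, c, \<zero>, d]"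
    by (intro has_min_poly_primitive_elementI[OF F t prim\<zeta>]) (use cl in auto)
qed

section \<open>Reduction of the given quartic to depressed form\<close>

theorem corollary2p2:
  fixes L :: "('a, 'b) ring_scheme" (structure)
    and F :: "'a set" and P :: "'a list"
    and x u v w z P0 P1 P2 :: 'a
  assumes quartic: "quartic_extension L F"
    and char: "ring_char (L\<lparr>carrier := F\<rparr>) \<noteq> 2"
    and prim: "primitive_element L F x"
    and coeffs: "u \<in> F" "v \<in> F" "w \<in> F" "z \<in> F"
    and P: "P = [\<one>, u, v, w, z]"
    and min_poly: "has_min_poly L F x P"
    and P0: "P0 = ring.eval L P (\<ominus> (u \<oslash> [(4::nat)] \<cdot> \<one>))"
    and P1: "P1 = ring.eval L (ring.formal_deriv L P) (\<ominus> (u \<oslash> [(4::nat)] \<cdot> \<one>))"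
    and P2: "P2 = ring.eval L (ring.formal_deriv L (ring.formal_deriv L P))
                    (\<ominus> (u \<oslash> [(4::nat)] \<cdot> \<one>))"
  shows
    "(P1 = \<zero> \<longrightarrow>
       (let y = x \<oplus> u \<oslash> [(4::nat)] \<cdot> \<one> in
          primitive_element L F y \<and>
          has_min_poly L F y [\<one>, \<zero>, (\<one> \<oslash> [(2::nat)] \<cdot> \<one>) \<otimes> P2, \<zero>, P0]))
     \<and>
     (P1 \<noteq> \<zero> \<longrightarrow>
       (let y = (P1 \<oslash> P0) \<otimes> (x \<oplus> u \<oslash> [(4::nat)] \<cdot> \<one>);
            a = (P1 [^] (2::nat) \<otimes> P2) \<oslash> ([(2::nat)] \<cdot> (P0 [^] (2::nat)));
            b = P1 [^] (4::nat) \<oslash> P0 [^] (3::nat) in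
          primitive_element L F y \<and>
          has_min_poly L F y [\<one>, \<zero>, a, b, b]) \<and>
       (let \<zeta> = ([(4::nat)] \<cdot> P0) \<oslash> (P1 \<otimes> ([(4::nat)] \<cdot> x \<oplus> u));
            c = (P2 \<otimes> P0) \<oslash> ([(2::nat)] \<cdot> (P1 [^] (2::nat)));
            d = P0 [^] (3::nat) \<oslash> P1 [^] (4::nat) in
          primitive_element L F \<zeta> \<and>
          has_min_poly L F \<zeta> [\<one>, \<one>, c, \<zero>, d]))"
proof -
  have "field L" and F: "subfield F L"
    using quartic by (simp_all add: quartic_extension_def)
  interpret field L by fact
  note cl = subringE[OF subfieldE(1)[OF F]]
  have FL: "F \<subseteq> carrier L" by (rule subfieldE(3)[OF F])
  have uvwz: "u \<in> carrier L" "v \<in> carrier L" "w \<in> carrier L" "z \<in> carrier L"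
    using coeffs FL by auto
  have x: "x \<in> carrier L" using prim by (simp add: primitive_element_def)
  have two: "[(2::nat)] \<cdot> \<one> \<noteq> \<zero>"
    by (rule two_nonzero_if_ring_char[OF F char])
  have four: "[(4::nat)] \<cdot> \<one> \<noteq> \<zero>"
  proof -
    have "[(4::nat)] \<cdot> \<one> = [(2::nat)] \<cdot> \<one> \<otimes> [(2::nat)] \<cdot> \<one>"
      by (simp add: add_pow_ldistr add.nat_pow_pow)
    then show ?thesis using two integral_iff by simp
  qed
  define q where "q = u \<oslash> [(4::nat)] \<cdot> \<one>"
  define t where "t = x \<oplus> q"
  \<comment> \<open>The quadratic Taylor coefficient of \<open>P\<close> at
    \<open>-u/4\<close>.\<close>
  define h where "h = [(6::nat)] \<cdot> (\<ominus> q \<otimes> \<ominus> q) \<oplus> [(3::nat)] \<cdot> (u \<otimes> \<ominus> q) \<oplus> v"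
  have q: "q \<in> F"
    unfolding q_def ring_div_def
    using coeffs(1) four subfield_m_inv(1)[OF F] add_pow_in_subring[OF subfieldE(1)[OF F]] cl(3,6)
    by auto
  have qL: "q \<in> carrier L" "\<ominus> q \<in> carrier L" and tL: "t \<in> carrier L"
    using q FL x by (auto simp: t_def)
  have u4: "u = [(4::nat)] \<cdot> q"
  proof -
    have "u = q \<otimes> [(4::nat)] \<cdot> \<one>"
      using div_eq_iff[of u "[(4::nat)] \<cdot> \<one>" q] uvwz qL four q_def by auto
    then show ?thesis using qL by (simp add: add_pow_rdistr)
  qed
  have derivs: "P1 = eval [[(4::nat)] \<cdot> \<one>, [(3::nat)] \<cdot> u, [(2::nat)] \<cdot> v, w] (\<ominus> q)"
    "P2 = [(2::nat)] \<cdot> h"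
    using uvwz qL four unfolding P1 P2 P q_def[symmetric] h_def
    by (simp_all add: formal_deriv_monic_quartic eval_formal_deriv_cubic
        eval_second_deriv_quartic del: eval.simps)
  note mult_F = add_pow_in_subring[OF subfieldE(1)[OF F]]
  have mq: "\<ominus> q \<in> F" using q cl(5) by blast
  have in_F: "h \<in> F" "P1 \<in> F" "P0 \<in> F"
  proof -
    show "h \<in> F"
      unfolding h_def by (intro cl(6,7) mult_F mq coeffs)
    show "P1 \<in> F"
      unfolding derivs(1) by (rule eval_in_subring[OF subfieldE(1)[OF F] _ mq])
        (simp add: cl(3) mult_F coeffs)
    show "P0 \<in> F"
      unfolding P0 P q_def[symmetric] by (rule eval_in_subring[OF subfieldE(1)[OF F] _ mq])
        (simp add: cl(3) coeffs)
  qed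
  have primt: "primitive_element L F t"
  proof (rule primitive_element_transfer[OF F prim tL])
    have "x = t \<oplus> \<ominus> q" unfolding t_def using x qL by algebra
    then show "x \<in> generate_field L (insert t F)"
      using q by (auto intro: generate_field.intros)
  qed
  have "eval [\<one>, \<zero>, h, P1, P0] t = eval P (t \<oplus> \<ominus> q)"
  proof -
    \<comment> \<open>This is the cubic Taylor coefficient; its vanishing is the reason for
      expanding at \<open>-u/4\<close>.\<close>
    have "[(4::nat)] \<cdot> (\<ominus> q) \<oplus> u = \<zero>"
      using qL(1) unfolding u4 by (simp add: numeral_eq_Suc) algebra
    then show ?thesis
      unfolding P derivs(1) P0 h_def q_def[symmetric]
      using eval_monic_quartic_add[OF uvwz qL(2) tL] by (simp del: eval.simps)
  qed
  also have "t \<oplus> \<ominus> q = x"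
    unfolding t_def using x qL by algebra
  also have "eval P x = \<zero>"
    by (rule eval_min_poly[OF F min_poly])
  \<comment> \<open>Valid for every value of \<open>P1\<close>. With \<open>P1 = 0\<close> and
    \<open>h\<close> rewritten by \<open>half\<close>, it is already the first claim.\<close>
  finally have mint: "has_min_poly L F t [\<one>, \<zero>, h, P1, P0]"
    by (intro has_min_poly_primitive_elementI[OF F prim min_poly primt])
      (use in_F cl P in \<open>auto simp del: eval.simps\<close>)
  have half: "(\<one> \<oslash> [(2::nat)] \<cdot> \<one>) \<otimes> P2 = h"
  proof -
    have hL: "h \<in> carrier L" using in_F FL by auto
    have "P2 = ([(2::nat)] \<cdot> \<one>) \<otimes> h"
      using hL by (simp add: derivs add_pow_ldistr)
    then show ?thesis
      using hL two field_Units by (simp add: ring_div_def m_assoc[symmetric])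
  qed
  \<comment> \<open>Brings the denominator of \<zeta> into the shape expected by
    \<open>quartic_normal_forms\<close>.\<close>
  have t4: "[(4::nat)] \<cdot> x \<oplus> u = [(4::nat)] \<cdot> t"
    using x qL unfolding t_def u4 by (simp add: add.nat_pow_distrib)
  show ?thesis
    unfolding Let_def q_def[symmetric] t_def[symmetric] t4 half
    \<comment> \<open>The open slot is the assumption that \<open>P1\<close> is nonzero, supplied by
      the second case. The reflexivity facts instantiate the defining equations with the formulas of
      the goal.\<close>
    using primt mint quartic_normal_forms[OF F two primt mint in_F _ derivs(2) refl refl refl refl refl refl]
    by auto
qed

end
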